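(* Let $r>k\ge 2$ and let $G$ and $F$ be $r$-graphs such that $G$ is not $k$-shadow-homomorphic to $F$. Then there exists a constant $c$ depending only on $F$ such that, for all sufficiently large $n$, $$f_{F,G}(n)\le c(\log n)^{\frac{1}{k-1}}.$$
   Context: An $r$-graph is an $r$-uniform hypergraph. An $r$-graph is $G$-free if it contains no (not necessarily induced) subgraph isomorphic to $G$. For $r$-graphs $F,G$ and $n\ge1$, $f_{F,G}(n)$ is the maximum integer $m$ such that every $n$-vertex $G$-free $r$-graph contains an $F$-free induced subgraph on $m$ vertices. For an $r$-graph $H$, $\partial_k H=\bigcup_{e\in E(H)}\binom{e}{k}$ is its $k$-shadow. An $r$-graph $A$ is $k$-shadow-homomorphic to an $r$-graph $B$ if one can choose for each $S\in\partial_k A$ a set $f(S)\in\partial_k B$ and a bijection $g_S:S\to f(S)$ such that for every edge $e\in E(A)$ there exist an edge $e'\in E(B)$ and a bijection $g:e\to e'$ with $g|_S=g_S$ for every $S\in\binom{e}{k}$. *)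

theory Defs
  imports Complex_Main "HOL-Library.Ramsey"
begin

datatype 'a hypergraph = Hypergraph (verts: "'a set") (edges: "'a set set")

definition rgraph :: "nat \<Rightarrow> 'a hypergraph \<Rightarrow> bool" where
  "rgraph r H \<longleftrightarrow> finite (verts H) \<and> edges H \<subseteq> nsets (verts H) r"

definition subgraph :: "'a hypergraph \<Rightarrow> 'a hypergraph \<Rightarrow> bool" where
  "subgraph H' H \<longleftrightarrow> verts H' \<subseteq> verts H \<and> edges H' \<subseteq> edges H"

definition isomorphic :: "'a hypergraph \<Rightarrow> 'b hypergraph \<Rightarrow> bool" where
  "isomorphic G H \<longleftrightarrow>
     (\<exists>\<phi>. bij_betw \<phi> (verts G) (verts H) \<and> edges H = (\<lambda>e. \<phi> ` e) ` edges G)"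

definition is_free :: "'a hypergraph \<Rightarrow> 'b hypergraph \<Rightarrow> bool" where
  "is_free G H \<longleftrightarrow> \<not> (\<exists>H'. subgraph H' H \<and> isomorphic G H')"

definition induced :: "'a hypergraph \<Rightarrow> 'a set \<Rightarrow> 'a hypergraph" where
  "induced H S = Hypergraph S {e \<in> edges H. e \<subseteq> S}"

text \<open>The uniformity \<open>r\<close> is an explicit argument because it cannot be recovered from edgeless
  \<open>F\<close> and \<open>G\<close>.  Host graphs have vertices in \<^typ>\<open>nat\<close>, which covers every finite graph up to
  isomorphism.  If \<open>F\<close> has a vertex and \<open>G\<close> has an edge, the set below contains \<open>0\<close> and is
  bounded by \<open>n\<close>, so that the maximum exists.\<close>

definition free_max :: "nat \<Rightarrow> 'a hypergraph \<Rightarrow> 'b hypergraph \<Rightarrow> nat \<Rightarrow> nat" where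
  "free_max r F G n = Max {m. \<forall>H :: nat hypergraph.
     rgraph r H \<and> card (verts H) = n \<and> is_free G H \<longrightarrow>
     (\<exists>S \<subseteq> verts H. card S = m \<and> is_free F (induced H S))}"

definition shadow :: "nat \<Rightarrow> 'a hypergraph \<Rightarrow> 'a set set" where
  "shadow k H = (\<Union>e\<in>edges H. nsets e k)"

definition shadow_homomorphic :: "nat \<Rightarrow> 'a hypergraph \<Rightarrow> 'b hypergraph \<Rightarrow> bool" where
  "shadow_homomorphic k A B \<longleftrightarrow>
     (\<exists>(f :: 'a set \<Rightarrow> 'b set) (g :: 'a set \<Rightarrow> 'a \<Rightarrow> 'b).
        (\<forall>S\<in>shadow k A. f S \<in> shadow k B \<and> bij_betw (g S) S (f S)) \<and>
        (\<forall>e\<in>edges A. \<exists>e'\<in>edges B. \<exists>h. bij_betw h e e' \<and>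
           (\<forall>S\<in>nsets e k. \<forall>x\<in>S. h x = g S x)))"

end

theory Submission
  imports Defs "HOL-Library.FuncSet"
begin

text \<open>Label every \<open>k\<close>-subset \<open>S\<close> of \<open>{..<n}\<close> with a random map \<open>g S : S \<rightarrow> V(F)\<close>, and let an
  \<open>r\<close>-set \<open>e\<close> be an edge of \<open>H\<close> if the labels of its \<open>k\<close>-subsets are the restrictions of one
  bijection from \<open>e\<close> onto an edge of \<open>F\<close>. The labels seen by a copy of \<open>G\<close> in \<open>H\<close> would form a
  \<open>k\<close>-shadow-homomorphism from \<open>G\<close> to \<open>F\<close>, so \<open>H\<close> is always \<open>G\<close>-free.

  Let \<open>v = |V(F)|\<close>. An \<open>m\<close>-set contains a family of order \<open>m\<^sup>k\<close> of \<open>v\<close>-sets that pairwise share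
  fewer than \<open>k\<close> vertices. On each of them independently the labels are, with constant
  probability, the restrictions of a fixed bijection onto \<open>V(F)\<close>, which produces a copy of
  \<open>F\<close>. So an \<open>m\<close>-set is \<open>F\<close>-free with probability at most \<open>exp (- \<delta> m\<^sup>k)\<close>, and the union bound
  over at most \<open>n\<^sup>m\<close> sets succeeds once \<open>m\<^sup>k\<^sup>-\<^sup>1\<close> exceeds a constant multiple of \<open>ln n\<close>.\<close>

section \<open>Packings of \<open>v\<close>-sets with small pairwise intersections\<close>

lemma card_nsets_superset:
  assumes "finite M" "T \<subseteq> M" "card T = k" "k \<le> v"
  shows "card {W \<in> nsets M v. T \<subseteq> W} = (card M - k) choose (v - k)"
proof -
  have fT: "finite T" using assms finite_subset by blast
  have "bij_betw (\<lambda>W. W - T) {W \<in> nsets M v. T \<subseteq> W} (nsets (M - T) (v - k))"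
  proof (rule bij_betw_byWitness[where f' = "\<lambda>W. W \<union> T"])
    show "\<forall>a\<in>{W \<in> nsets M v. T \<subseteq> W}. a - T \<union> T = a" by auto
    show "\<forall>a'\<in>nsets (M - T) (v - k). a' \<union> T - T = a'" by (auto simp: nsets_def)
    show "(\<lambda>W. W - T) ` {W \<in> nsets M v. T \<subseteq> W} \<subseteq> nsets (M - T) (v - k)"
      using assms fT by (auto simp: nsets_def card_Diff_subset)
    show "(\<lambda>W. W \<union> T) ` nsets (M - T) (v - k) \<subseteq> {W \<in> nsets M v. T \<subseteq> W}"
    proof (rule image_subsetI)
      fix W assume "W \<in> nsets (M - T) (v - k)"
      then have "W \<subseteq> M - T" "finite W" "card W = v - k" by (auto simp: nsets_def)
      moreover from this have "card (W \<union> T) = card W + card T"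
        using fT by (intro card_Un_disjoint) auto
      ultimately show "W \<union> T \<in> {W \<in> nsets M v. T \<subseteq> W}"
        using assms fT by (auto simp: nsets_def)
    qed
  qed
  then have "card {W \<in> nsets M v. T \<subseteq> W} = card (nsets (M - T) (v - k))"
    by (rule bij_betw_same_card)
  then show ?thesis using assms fT by (simp add: card_Diff_subset)
qed

text \<open>Take a maximal such family. Every \<open>v\<close>-subset of \<open>M\<close> then
  shares at least \<open>k\<close> vertices with some member, so it contains one of the
  \<open>v choose k\<close> many \<open>k\<close>-subsets of that member. Counting the supersets of
  these \<open>k\<close>-sets bounds the size of the family from below.\<close>

lemma exists_packing:
  assumes M: "finite M" and kv: "k \<le> v" and vM: "v \<le> card M"
  obtains P where "P \<subseteq> nsets M v"
    and "\<And>W W'. W \<in> P \<Longrightarrow> W' \<in> P \<Longrightarrow> W \<noteq> W' \<Longrightarrow> card (W \<inter> W') < k"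
    and "card M choose k \<le> (v choose k)\<^sup>2 * card P"
proof -
  define Fam where "Fam = {P. P \<subseteq> nsets M v \<and>
    (\<forall>W\<in>P. \<forall>W'\<in>P. W \<noteq> W' \<longrightarrow> card (W \<inter> W') < k)}"
  have fin: "finite (nsets M v)" using M by (simp add: finite_imp_finite_nsets)
  have "finite Fam" unfolding Fam_def by (rule finite_subset[of _ "Pow (nsets M v)"]) (use fin in auto)
  moreover have "{} \<in> Fam" by (simp add: Fam_def)
  ultimately obtain P where P: "P \<in> Fam" and maxP: "\<And>Q. Q \<in> Fam \<Longrightarrow> P \<subseteq> Q \<Longrightarrow> Q = P"
    using finite_has_maximal[of Fam] by (metis empty_iff)
  have PM: "P \<subseteq> nsets M v" and finP: "finite P"
    using P fin finite_subset by (auto simp: Fam_def)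
  define ext where "ext T = {W \<in> nsets M v. T \<subseteq> W}" for T
  have "nsets M v \<subseteq> (\<Union>W\<in>P. \<Union>T\<in>nsets W k. ext T)"
  proof
    fix W' assume W': "W' \<in> nsets M v"
    have "\<exists>W\<in>P. k \<le> card (W \<inter> W')"
    proof (cases "W' \<in> P")
      case True
      then show ?thesis using W' kv by (intro bexI[of _ W']) (auto simp: nsets_def)
    next
      case False
      \<comment> \<open>By maximality, a \<open>W'\<close> outside the family must conflict with a
        member of it.\<close>
      then have "insert W' P \<notin> Fam" using maxP by blast
      then obtain W where "W \<in> P" "\<not> card (W \<inter> W') < k"
        using P W' unfolding Fam_def by (auto simp: Int_commute)
      then show ?thesis by (auto simp: not_less)
    qed
    then obtain W where W: "W \<in> P" "k \<le> card (W \<inter> W')" by blast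
    then obtain T where "T \<subseteq> W \<inter> W'" "card T = k" "finite T"
      by (meson obtain_subset_with_card_n)
    then show "W' \<in> (\<Union>W\<in>P. \<Union>T\<in>nsets W k. ext T)"
      using W W' by (auto simp: nsets_def ext_def)
  qed
  moreover have "finite (\<Union>W\<in>P. \<Union>T\<in>nsets W k. ext T)"
    by (rule finite_subset[OF _ fin]) (auto simp: ext_def)
  ultimately have "card (nsets M v) \<le> card (\<Union>W\<in>P. \<Union>T\<in>nsets W k. ext T)"
    by (rule card_mono[rotated])
  also have "\<dots> \<le> (\<Sum>W\<in>P. card (\<Union>T\<in>nsets W k. ext T))"
    by (rule card_UN_le[OF finP])
  also have "\<dots> \<le> (\<Sum>W\<in>P. (v choose k) * ((card M - k) choose (v - k)))"
  proof (rule sum_mono)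
    fix W assume "W \<in> P"
    then have W: "W \<subseteq> M" "finite W" "card W = v" using PM by (auto simp: nsets_def)
    have "card (\<Union>T\<in>nsets W k. ext T) \<le> (\<Sum>T\<in>nsets W k. card (ext T))"
      using W by (intro card_UN_le finite_imp_finite_nsets)
    also have "\<dots> = (\<Sum>T\<in>nsets W k. (card M - k) choose (v - k))"
      unfolding ext_def
      by (intro sum.cong refl card_nsets_superset) (use M W kv in \<open>auto simp: nsets_def\<close>)
    finally show "card (\<Union>T\<in>nsets W k. ext T) \<le> (v choose k) * ((card M - k) choose (v - k))"
      using W by simp
  qed
  finally have "(card M choose v) \<le> card P * ((v choose k) * ((card M - k) choose (v - k)))"
    using M by simp
  \<comment> \<open>The extra factor \<open>v choose k\<close> lets \<open>choose_mult\<close>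
    rewrite the left side so that both sides carry the factor
    \<open>(card M - k) choose (v - k)\<close>, which is positive as \<open>v \<le> card M\<close>
    and can be cancelled.\<close>
  then have "(card M choose v) * (v choose k)
      \<le> card P * ((v choose k) * ((card M - k) choose (v - k))) * (v choose k)"
    by (rule mult_le_mono1)
  also have "\<dots> = ((v choose k)\<^sup>2 * card P) * ((card M - k) choose (v - k))"
    by (simp add: power2_eq_square)
  also have "(card M choose v) * (v choose k) = (card M choose k) * ((card M - k) choose (v - k))"
    using kv vM by (rule choose_mult)
  finally have "card M choose k \<le> (v choose k)\<^sup>2 * card P"
    using vM by (simp add: diff_le_mono)
  with PM P show ?thesis by (intro that[of P]) (auto simp: Fam_def)
qed

section \<open>Random labellings by counting\<close>

text \<open>A counting form of independence: a uniformly random function on \<open>D\<close> misses each of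
  the patterns \<open>p i\<close>, prescribed on disjoint blocks \<open>B i\<close>, independently with probability at most
  \<open>1 - 1 / N\<close>.\<close>

lemma card_avoiding_PiE:
  fixes N :: real
  assumes "finite P" "finite D" "\<And>x. x \<in> D \<Longrightarrow> finite (L x)"
    and "\<And>i. i \<in> P \<Longrightarrow> B i \<subseteq> D"
    and "\<And>i j. i \<in> P \<Longrightarrow> j \<in> P \<Longrightarrow> i \<noteq> j \<Longrightarrow> B i \<inter> B j = {}"
    and "\<And>i. i \<in> P \<Longrightarrow> p i \<in> PiE (B i) L"
    and "\<And>i. i \<in> P \<Longrightarrow> card (PiE (B i) L) \<le> N"
    and "1 \<le> N"
  shows "card {f \<in> PiE D L. \<forall>i\<in>P. \<exists>x\<in>B i. f x \<noteq> p i x} \<le> (1 - 1 / N) ^ card P * card (PiE D L)"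
  using assms
proof (induction P arbitrary: D rule: finite_induct)
  case empty
  then show ?case by simp
next
  case (insert i P)
  define D' where "D' = D - B i"
  define bad' where "bad' = {f \<in> PiE D' L. \<forall>j\<in>P. \<exists>x\<in>B j. f x \<noteq> p j x}"
  define bad where "bad = {f \<in> PiE D L. \<forall>j\<in>insert i P. \<exists>x\<in>B j. f x \<noteq> p j x}"
  have Bi: "B i \<subseteq> D" "finite (B i)" using insert.prems(1) insert.prems(3)[of i] by (auto intro: finite_subset)
  have BD': "B j \<subseteq> D'" if "j \<in> P" for j
    using that insert.prems(3)[of j] insert.prems(4)[of j i] insert.hyps by (auto simp: D'_def)
  have fin: "finite (PiE (B i) L)" "finite (PiE D' L)"
    using insert.prems(1,2) Bi by (auto intro!: finite_PiE simp: D'_def)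
  have IH: "card bad' \<le> (1 - 1 / N) ^ card P * card (PiE D' L)"
    unfolding bad'_def
    by (rule insert.IH) (use insert.prems BD' in \<open>auto simp: D'_def\<close>)
  \<comment> \<open>A function on \<open>D\<close> is determined by its restrictions to
    \<open>D'\<close> and \<open>B i\<close>. For a bad function the first is bad for
    \<open>P\<close> and the second differs from \<open>p i\<close>.\<close>
  have "inj_on (\<lambda>f. (restrict f D', restrict f (B i))) bad"
  proof (rule inj_onI)
    fix f g assume fg: "f \<in> bad" "g \<in> bad"
      "(restrict f D', restrict f (B i)) = (restrict g D', restrict g (B i))"
    have "f x = g x" if "x \<in> D" for x
      using fg(3) that by (metis D'_def DiffI Pair_inject restrict_apply')
    then show "f = g" using fg(1,2) by (auto simp: bad_def intro: PiE_ext)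
  qed
  moreover have "(\<lambda>f. (restrict f D', restrict f (B i))) ` bad \<subseteq> bad' \<times> (PiE (B i) L - {p i})"
  proof (rule image_subsetI)
    fix f assume f: "f \<in> bad"
    then have "restrict f D' \<in> PiE D' L" "restrict f (B i) \<in> PiE (B i) L"
      using Bi by (auto simp: bad_def D'_def PiE_iff)
    moreover have "\<exists>x\<in>B j. restrict f D' x \<noteq> p j x" if j: "j \<in> P" for j
    proof -
      obtain x where "x \<in> B j" "f x \<noteq> p j x" using f j by (auto simp: bad_def)
      then show ?thesis using BD'[OF j] by (intro bexI[of _ x]) auto
    qed
    moreover have "restrict f (B i) \<noteq> p i"
    proof -
      obtain x where "x \<in> B i" "f x \<noteq> p i x" using f by (auto simp: bad_def)
      then show ?thesis by (metis restrict_apply')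
    qed
    ultimately show "(restrict f D', restrict f (B i)) \<in> bad' \<times> (PiE (B i) L - {p i})"
      by (auto simp: bad'_def)
  qed
  moreover have "finite (bad' \<times> (PiE (B i) L - {p i}))" using fin by (auto simp: bad'_def)
  ultimately have "card bad \<le> card (bad' \<times> (PiE (B i) L - {p i}))"
    by (rule card_inj_on_le)
  also have "\<dots> = card bad' * (card (PiE (B i) L) - 1)"
    using insert.prems(5)[of i] fin by (simp add: card_cartesian_product)
  finally have "real (card bad) \<le> real (card bad') * real (card (PiE (B i) L) - 1)"
    by (metis of_nat_le_iff of_nat_mult)
  also have "\<dots> \<le> real (card bad') * ((1 - 1 / N) * card (PiE (B i) L))"
  proof (rule mult_left_mono)
    have "card (PiE (B i) L) \<ge> 1"
      using insert.prems(5)[of i] fin by (metis One_nat_def Suc_leI card_gt_0_iff empty_iff insertI1)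
    \<comment> \<open>With \<open>X = card (PiE (B i) L)\<close>, the goal
      \<open>X - 1 \<le> (1 - 1 / N) * X\<close> amounts to \<open>X / N \<le> 1\<close>.\<close>
    moreover have "card (PiE (B i) L) / N \<le> 1"
      using insert.prems(6)[of i] insert.prems(7) by simp
    ultimately show "real (card (PiE (B i) L) - 1) \<le> (1 - 1 / N) * card (PiE (B i) L)"
      by (simp add: of_nat_diff left_diff_distrib)
  qed simp
  also have "\<dots>
      \<le> ((1 - 1 / N) ^ card P * card (PiE D' L)) * ((1 - 1 / N) * card (PiE (B i) L))"
    using IH insert.prems(7) by (intro mult_right_mono) auto
  also have "\<dots> = (1 - 1 / N) ^ card (insert i P) * real (card (PiE D' L) * card (PiE (B i) L))"
    using insert.hyps by simp
  also have "card (PiE D' L) * card (PiE (B i) L) = card (PiE D L)"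
    using insert.prems(1) Bi by (simp add: card_PiE D'_def prod.subset_diff[of "B i" D])
  finally show ?case unfolding bad_def .
qed

text \<open>A label \<open>g S\<close> plays the role of the bijection \<open>g\<^sub>S\<close>; it is an arbitrary map \<open>S \<rightarrow> V\<close>, but
  only labels that restrict an injection will ever matter.\<close>

lemma exists_labelling:
  fixes V :: "'b set"
  assumes V: "finite V" "card V = v" "1 \<le> k" "k \<le> v" and vm: "v \<le> m" and n: "1 \<le> n"
    and large: "real m * ln (real n) <
      (real m / real k) ^ k / (real (v choose k) ^ 2 * real v ^ (k * (v choose k)))"
  shows "\<exists>g :: nat set \<Rightarrow> nat \<Rightarrow> 'b. \<forall>M \<in> nsets {..<n} m. \<exists>W \<subseteq> M. \<exists>\<phi>.
    bij_betw \<phi> W V \<and> (\<forall>S \<in> nsets W k. \<forall>x\<in>S. g S x = \<phi> x)"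
proof -
  define b where "b = v choose k"
  \<comment> \<open>The number of ways to label all \<open>k\<close>-subsets of one
    \<open>v\<close>-set: there are \<open>b\<close> of them, with \<open>v ^ k\<close> maps each. A
    prescribed pattern thus occurs with probability \<open>1 / N\<close>.\<close>
  define N where "N = real v ^ (k * b)"
  define L where "L S = PiE S (\<lambda>_. V)" for S :: "nat set"
  define D where "D = nsets {..<n} k"
  define good where "good g M \<longleftrightarrow> (\<exists>W \<subseteq> M. \<exists>\<phi>.
    bij_betw \<phi> W V \<and> (\<forall>S \<in> nsets W k. \<forall>x\<in>S. g S x = \<phi> x))" for g :: "nat set \<Rightarrow> nat \<Rightarrow> 'b" and M
  have v1: "1 \<le> v" using V by simp
  have N1: "1 \<le> N" unfolding N_def using v1 by (intro one_le_power) auto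
  have b1: "1 \<le> b" unfolding b_def using V by (simp add: Suc_leI)
  have finD: "finite D" unfolding D_def by (simp add: finite_imp_finite_nsets)
  have finL: "finite (L S)" if "S \<in> nsets A k" for S A
    unfolding L_def using that V by (intro finite_PiE) (auto simp: nsets_def)
  have cardL: "card (L S) = v ^ k" if "S \<in> nsets A k" for S A
    unfolding L_def using that V by (simp add: card_PiE nsets_def)
  have finT: "finite (PiE D L)" using finD finL by (intro finite_PiE) (auto simp: D_def)
  have T0: "card (PiE D L) > 0"
    using finD cardL v1 by (simp add: card_PiE D_def prod_pos)
  \<comment> \<open>Bounds the probability that a fixed \<open>m\<close>-set is not good:
    \<open>(1 - 1 / N) ^ card P\<close> is at most \<open>exp (- (card P / N))\<close>, and the
    packing has at least \<open>(m / k) ^ k / b ^ 2\<close> members.\<close>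
  define \<epsilon> where "\<epsilon> = exp (- ((real m / real k) ^ k / (real b ^ 2 * N)))"
  have bad: "card {g \<in> PiE D L. \<not> good g M} \<le> \<epsilon> * card (PiE D L)" if M: "M \<in> nsets {..<n} m" for M
  proof -
    have M': "M \<subseteq> {..<n}" "finite M" "card M = m" using M by (auto simp: nsets_def)
    obtain P where P: "P \<subseteq> nsets M v"
      and Pk: "\<And>W W'. W \<in> P \<Longrightarrow> W' \<in> P \<Longrightarrow> W \<noteq> W' \<Longrightarrow> card (W \<inter> W') < k"
      and cP: "m choose k \<le> b\<^sup>2 * card P"
      using exists_packing[of M k v] M' V vm by (metis b_def)
    have finP: "finite P" using P M' finite_imp_finite_nsets finite_subset by blast
    have PW: "finite W" "card W = v" "W \<subseteq> M" if "W \<in> P" for W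
      using P that by (auto simp: nsets_def)
    have "\<exists>\<phi>. bij_betw \<phi> W V" if "W \<in> P" for W
      using PW[OF that] V by (intro finite_same_card_bij) auto
    then obtain \<phi> where \<phi>: "\<And>W. W \<in> P \<Longrightarrow> bij_betw (\<phi> W) W V" by metis
    define p where "p W = (\<lambda>S\<in>nsets W k. restrict (\<phi> W) S)" for W
    have p: "p W S x = \<phi> W x" if "S \<in> nsets W k" "x \<in> S" for W S x
      using that by (simp add: p_def)
    have sub: "{g \<in> PiE D L. \<not> good g M} \<subseteq>
        {g \<in> PiE D L. \<forall>W\<in>P. \<exists>S\<in>nsets W k. g S \<noteq> p W S}"
    proof (intro subsetI CollectI conjI ballI)
      fix g assume g: "g \<in> {g \<in> PiE D L. \<not> good g M}"
      then show "g \<in> PiE D L" by simp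
      fix W assume W: "W \<in> P"
      show "\<exists>S\<in>nsets W k. g S \<noteq> p W S"
      proof (rule ccontr)
        assume "\<not> (\<exists>S\<in>nsets W k. g S \<noteq> p W S)"
        then have "\<forall>S\<in>nsets W k. \<forall>x\<in>S. g S x = \<phi> W x" using p by metis
        then have "good g M" using \<phi>[OF W] PW(3)[OF W] unfolding good_def by blast
        then show False using g by simp
      qed
    qed
    have "card {g \<in> PiE D L. \<not> good g M} \<le> card {g \<in> PiE D L. \<forall>W\<in>P. \<exists>S\<in>nsets W k. g S \<noteq> p W S}"
      by (rule card_mono[OF _ sub]) (use finT in auto)
    also have "real \<dots> \<le> (1 - 1 / N) ^ card P * card (PiE D L)"
    proof (rule card_avoiding_PiE[OF finP finD])
      show "finite (L S)" if "S \<in> D" for S using that finL by (auto simp: D_def)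
      show "nsets W k \<subseteq> D" if "W \<in> P" for W
        using PW[OF that] M' by (auto simp: D_def nsets_def)
      \<comment> \<open>The packing condition yields independence here: a common
        \<open>k\<close>-subset would lie in \<open>W \<inter> W'\<close>, which has fewer than
        \<open>k\<close> vertices.\<close>
      show "nsets W k \<inter> nsets W' k = {}" if "W \<in> P" "W' \<in> P" "W \<noteq> W'" for W W'
      proof (rule ccontr)
        assume "nsets W k \<inter> nsets W' k \<noteq> {}"
        then obtain S where "S \<subseteq> W \<inter> W'" "card S = k" by (auto simp: nsets_def)
        then show False using Pk[OF that] PW[OF that(1)]
          by (metis card_mono finite_Int leD)
      qed
      show "p W \<in> PiE (nsets W k) L" if "W \<in> P" for W
        using bij_betw_apply[OF \<phi>[OF that]]
        by (auto simp: p_def L_def PiE_iff nsets_def)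
      show "real (card (PiE (nsets W k) L)) \<le> N" if "W \<in> P" for W
        using PW[OF that] cardL
        by (simp add: card_PiE finite_imp_finite_nsets N_def b_def power_mult)
    qed (rule N1)
    also have "\<dots> \<le> \<epsilon> * card (PiE D L)"
    proof (rule mult_right_mono)
      have "(1 - 1 / N) ^ card P \<le> exp (- (1 / N)) ^ card P"
        using N1 exp_ge_add_one_self[of "- (1 / N)"] by (intro power_mono) auto
      also have "\<dots> = exp (- (card P / N))"
        by (simp add: exp_of_nat_mult[symmetric])
      also have "\<dots> \<le> \<epsilon>"
      proof -
        have "(real m / real k) ^ k \<le> real (m choose k)"
          using binomial_ge_n_over_k_pow_k[of k m, where ?'a = real] V vm by simp
        also have "\<dots> \<le> real b ^ 2 * card P" using cP
          by (metis of_nat_le_iff of_nat_mult of_nat_power)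
        finally have "(real m / real k) ^ k / real b ^ 2 \<le> card P"
          using b1 by (simp only: pos_divide_le_eq zero_less_power of_nat_0_less_iff mult.commute)
        then have "(real m / real k) ^ k / real b ^ 2 / N \<le> card P / N"
          using N1 by (intro divide_right_mono) auto
        then show ?thesis unfolding \<epsilon>_def by simp
      qed
      finally show "(1 - 1 / N) ^ card P \<le> \<epsilon>" .
    qed simp
    finally show ?thesis by simp
  qed
  \<comment> \<open>Union bound over all \<open>m\<close>-subsets of the vertex set.\<close>
  have "card (\<Union>M\<in>nsets {..<n} m. {g \<in> PiE D L. \<not> good g M})
      \<le> (\<Sum>M\<in>nsets {..<n} m. card {g \<in> PiE D L. \<not> good g M})"
    by (intro card_UN_le finite_imp_finite_nsets) simp
  also have "real \<dots> \<le> (\<Sum>M\<in>nsets {..<n} m. \<epsilon> * card (PiE D L))"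
    unfolding of_nat_sum by (intro sum_mono bad)
  also have "\<dots> = real (n choose m) * (\<epsilon> * card (PiE D L))" by simp
  also have "\<dots> \<le> real (n ^ m) * (\<epsilon> * card (PiE D L))"
  proof (rule mult_right_mono)
    show "real (n choose m) \<le> real (n ^ m)"
      by (cases "m \<le> n") (simp_all add: binomial_le_pow binomial_eq_0 del: of_nat_power)
  qed (simp add: \<epsilon>_def)
  \<comment> \<open>Writing \<open>n ^ m\<close> as an exponential turns the required bound into the
    hypothesis \<open>large\<close>.\<close>
  also have "\<dots> = exp (real m * ln (real n)) * \<epsilon> * card (PiE D L)"
    using n by (simp add: exp_of_nat_mult)
  also have "\<dots> < 1 * real (card (PiE D L))"
  proof (rule mult_strict_right_mono)
    have "exp (real m * ln (real n)) * \<epsilon> = exp (real m * ln (real n) - (real m / real k) ^ k / (real b ^ 2 * N))"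
      by (simp add: \<epsilon>_def exp_diff exp_minus divide_inverse)
    also have "\<dots> < 1" using large by (simp add: b_def N_def)
    finally show "exp (real m * ln (real n)) * \<epsilon> < 1" .
  qed (use T0 in simp)
  finally have "card (\<Union>M\<in>nsets {..<n} m. {g \<in> PiE D L. \<not> good g M}) < card (PiE D L)" by simp
  then have "(\<Union>M\<in>nsets {..<n} m. {g \<in> PiE D L. \<not> good g M}) \<noteq> PiE D L" by auto
  then obtain g where "\<forall>M\<in>nsets {..<n} m. good g M" by blast
  then show ?thesis unfolding good_def by blast
qed

section \<open>The graph defined by a labelling\<close>

text \<open>The edge condition repeats the one in \<open>shadow_homomorphic\<close>, so for every
  labelling the graph is \<open>k\<close>-shadow-homomorphic to \<open>F\<close> by
  construction.\<close>

definition label_graph :: "nat \<Rightarrow> nat \<Rightarrow> 'b hypergraph \<Rightarrow> ('a set \<Rightarrow> 'a \<Rightarrow> 'b) \<Rightarrow> 'a set \<Rightarrow> 'a hypergraph" where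
  "label_graph r k F g A = Hypergraph A {e \<in> nsets A r. \<exists>e'\<in>edges F. \<exists>h.
     bij_betw h e e' \<and> (\<forall>S\<in>nsets e k. \<forall>x\<in>S. h x = g S x)}"

lemma rgraph_label_graph: "finite A \<Longrightarrow> rgraph r (label_graph r k F g A)"
  by (auto simp: rgraph_def label_graph_def)

lemma nsets_image_inj_on:
  "inj_on \<phi> e \<Longrightarrow> S \<in> nsets e k \<Longrightarrow> \<phi> ` S \<in> nsets (\<phi> ` e) k"
  by (auto simp: nsets_def card_image inj_on_subset)

text \<open>A shadow homomorphism pulls back along an embedding: the labels seen by a copy of
  \<open>G\<close>, transported by \<open>\<phi>\<close>, would map \<open>G\<close> to
  \<open>F\<close>.\<close>

lemma is_free_label_graph:
  assumes G: "rgraph r G" and nh: "\<not> shadow_homomorphic k G F"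
  shows "is_free G (label_graph r k F g A)"
  unfolding is_free_def
proof clarify
  fix H' assume sub: "subgraph H' (label_graph r k F g A)" and "isomorphic G H'"
  then obtain \<phi> where \<phi>: "bij_betw \<phi> (verts G) (verts H')" "edges H' = (\<lambda>e. \<phi> ` e) ` edges G"
    by (auto simp: isomorphic_def)
  define g' where "g' S x = g (\<phi> ` S) (\<phi> x)" for S x
  have main: "\<exists>e'\<in>edges F. \<exists>h. bij_betw h e e' \<and> (\<forall>S\<in>nsets e k. \<forall>x\<in>S. h x = g' S x)"
    if e: "e \<in> edges G" for e
  proof -
    have "e \<subseteq> verts G" using G e by (auto simp: rgraph_def nsets_def)
    then have inj: "inj_on \<phi> e" using \<phi>(1) by (meson bij_betw_def inj_on_subset)
    have "\<phi> ` e \<in> edges (label_graph r k F g A)"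
      using sub e \<phi>(2) by (auto simp: subgraph_def)
    then obtain e' h where h: "e' \<in> edges F" "bij_betw h (\<phi> ` e) e'"
      "\<And>S x. S \<in> nsets (\<phi> ` e) k \<Longrightarrow> x \<in> S \<Longrightarrow> h x = g S x"
      by (auto simp: label_graph_def)
    have "bij_betw (h \<circ> \<phi>) e e'"
      using inj h(2) by (intro bij_betw_trans) (auto simp: bij_betw_def)
    moreover have "(h \<circ> \<phi>) x = g' S x" if "S \<in> nsets e k" "x \<in> S" for S x
      using h(3)[OF nsets_image_inj_on[OF inj that(1)]] that by (simp add: g'_def)
    ultimately show ?thesis using h(1) by blast
  qed
  \<comment> \<open>Each set of the shadow lies in an edge, where its label agrees with an injective
    \<open>h\<close>. Hence the image of the label can serve as \<open>f S\<close>.\<close>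
  have "g' S ` S \<in> shadow k F \<and> bij_betw (g' S) S (g' S ` S)" if S: "S \<in> shadow k G" for S
  proof -
    obtain e where e: "e \<in> edges G" "S \<in> nsets e k" using S by (auto simp: shadow_def)
    then obtain e' h where h: "e' \<in> edges F" "bij_betw h e e'" "\<And>x. x \<in> S \<Longrightarrow> h x = g' S x"
      using main by metis
    have "inj_on h S" using h(2) e(2) by (auto simp: bij_betw_def nsets_def intro: inj_on_subset)
    then have "inj_on (g' S) S" using h(3) inj_on_cong by metis
    moreover have "h ` S \<in> nsets e' k"
      using nsets_image_inj_on[of h e S k] h(2) e(2) by (auto simp: bij_betw_def)
    moreover have "h ` S = g' S ` S" using h(3) by (auto simp: image_iff)
    ultimately show ?thesis using h(1) by (auto simp: shadow_def bij_betw_def)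
  qed
  then have "shadow_homomorphic k G F"
    unfolding shadow_homomorphic_def using main
    by (intro exI[of _ "\<lambda>S. g' S ` S"] exI[of _ g']) blast
  with nh show False by blast
qed

text \<open>The inverse of \<open>\<phi>\<close> embeds \<open>F\<close> into \<open>W\<close>. On
  the image of each edge, \<open>\<phi>\<close> itself is the bijection that the edge condition asks
  for, since all labels inside \<open>W\<close> are restrictions of it.\<close>

lemma not_is_free_label_graph:
  assumes F: "rgraph r F" and W: "W \<subseteq> M" "M \<subseteq> A" and \<phi>: "bij_betw \<phi> W (verts F)"
    and g: "\<And>S x. S \<in> nsets W k \<Longrightarrow> x \<in> S \<Longrightarrow> g S x = \<phi> x"
  shows "\<not> is_free F (induced (label_graph r k F g A) M)"
proof -
  define \<psi> where "\<psi> = inv_into W \<phi>"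
  have \<psi>: "bij_betw \<psi> (verts F) W" unfolding \<psi>_def using \<phi> by (rule bij_betw_inv_into)
  have \<phi>\<psi>: "\<phi> (\<psi> y) = y" if "y \<in> verts F" for y
    using that \<phi> unfolding \<psi>_def by (rule bij_betw_inv_into_right[rotated])
  define H' where "H' = Hypergraph W ((\<lambda>e. \<psi> ` e) ` edges F)"
  have "isomorphic F H'" unfolding isomorphic_def H'_def using \<psi> by auto
  moreover have "subgraph H' (induced (label_graph r k F g A) M)"
  proof -
    have "\<psi> ` e \<in> edges (label_graph r k F g A) \<and> \<psi> ` e \<subseteq> M" if e: "e \<in> edges F" for e
    proof -
      have er: "e \<in> nsets (verts F) r" using F e by (auto simp: rgraph_def)
      then have eV: "e \<subseteq> verts F" by (auto simp: nsets_def)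
      have "\<psi> ` e \<in> nsets W r"
        using nsets_image_inj_on[of \<psi> "verts F" e r] \<psi> er by (auto simp: bij_betw_def)
      then have rW: "\<psi> ` e \<in> nsets A r" "\<psi> ` e \<subseteq> W" using W by (auto simp: nsets_def)
      have "\<phi> ` \<psi> ` e = e" using \<phi>\<psi> eV by (force simp: image_iff)
      then have "bij_betw \<phi> (\<psi> ` e) e"
        using \<phi> rW(2) by (auto simp: bij_betw_def intro: inj_on_subset)
      moreover have "\<phi> x = g S x" if "S \<in> nsets (\<psi> ` e) k" "x \<in> S" for S x
        using g[of S x] that rW(2) by (auto simp: nsets_def)
      ultimately show ?thesis using e rW W by (auto simp: label_graph_def)
    qed
    then show ?thesis using W by (auto simp: subgraph_def H'_def induced_def)
  qed
  ultimately show ?thesis unfolding is_free_def by blast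
qed

section \<open>Upper bounds on \<open>free_max\<close>\<close>

lemma is_free_induced_mono:
  assumes "is_free F (induced H S)" "T \<subseteq> S"
  shows "is_free F (induced H T)"
proof -
  have "subgraph H' (induced H S)" if "subgraph H' (induced H T)" for H'
    using that assms(2) by (auto simp: induced_def subgraph_def)
  then show ?thesis using assms(1) unfolding is_free_def by blast
qed

lemma is_free_empty: "verts F \<noteq> {} \<Longrightarrow> is_free F (induced H {})"
  by (auto simp: is_free_def induced_def subgraph_def isomorphic_def bij_betw_def)

text \<open>One host graph suffices, because \<open>F\<close>-freeness is hereditary: a larger
  \<open>F\<close>-free vertex set would contain one of size exactly \<open>m\<close>.\<close>

lemma free_max_less:
  fixes H :: "nat hypergraph"
  assumes F: "verts F \<noteq> {}"
    and H: "rgraph r H" "card (verts H) = n" "is_free G H"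
    and m: "\<And>S. S \<subseteq> verts H \<Longrightarrow> card S = m \<Longrightarrow> \<not> is_free F (induced H S)"
  shows "free_max r F G n < m"
proof -
  define X where "X = {m. \<forall>H :: nat hypergraph.
     rgraph r H \<and> card (verts H) = n \<and> is_free G H \<longrightarrow>
     (\<exists>S \<subseteq> verts H. card S = m \<and> is_free F (induced H S))}"
  have less: "x < m" if x: "x \<in> X" for x
  proof (rule ccontr)
    assume "\<not> x < m"
    moreover obtain S where S: "S \<subseteq> verts H" "card S = x" "is_free F (induced H S)"
      using x H by (auto simp: X_def)
    ultimately obtain T where "T \<subseteq> S" "card T = m"
      by (metis not_less obtain_subset_with_card_n)
    then show False using m[of T] S is_free_induced_mono by blast
  qed
  \<comment> \<open>\<open>Max\<close> is meaningful only on a nonempty set; the empty vertex set is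
    \<open>F\<close>-free because \<open>F\<close> has a vertex.\<close>
  have "0 \<in> X" unfolding X_def using is_free_empty[OF F] by (auto intro!: exI[of _ "{}"])
  moreover have "finite X" using less by (meson finite_nat_iff_bounded subsetI lessThan_iff)
  ultimately have "Max X < m" using less by (subst Max_less_iff) auto
  then show ?thesis by (simp add: free_max_def X_def)
qed

lemma is_free_edgeless: "edges G \<noteq> {} \<Longrightarrow> is_free G (Hypergraph A {})"
  by (auto simp: is_free_def subgraph_def isomorphic_def)

text \<open>If \<open>F\<close> has no vertex, no graph is \<open>F\<close>-free and \<^const>\<open>free_max\<close> is the unspecified
  constant \<open>Max {}\<close>, whence the existentially quantified bound.\<close>

lemma free_max_bounded_edgeless:
  assumes F: "finite (verts F)" "edges F = {}" and G: "edges G \<noteq> {}"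
  shows "\<exists>K. \<forall>n. free_max r F G n \<le> K"
proof -
  define H where "H n = Hypergraph {..<n} ({} :: nat set set)" for n
  have H: "rgraph r (H n)" "card (verts (H n)) = n" "is_free G (H n)" for n
    using is_free_edgeless[OF G] by (auto simp: H_def rgraph_def)
  have iso: "\<not> is_free F (induced (H n) S)" if "bij_betw \<phi> (verts F) T" "T \<subseteq> S" for \<phi> S T n
  proof -
    have "isomorphic F (Hypergraph T {})" using F(2) that by (auto simp: isomorphic_def)
    moreover have "subgraph (Hypergraph T {}) (induced (H n) S)"
      using that by (auto simp: subgraph_def induced_def)
    ultimately show ?thesis unfolding is_free_def by blast
  qed
  show ?thesis
  proof (cases "verts F = {}")
    case True
    then have "\<not> is_free F (induced (H n) S)" for n S
      using iso[of _ "{}"] by (simp add: bij_betw_def)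
    then have E: "{m. \<forall>H :: nat hypergraph. rgraph r H \<and> card (verts H) = n \<and> is_free G H \<longrightarrow>
       (\<exists>S \<subseteq> verts H. card S = m \<and> is_free F (induced H S))} = {}" for n
      using H by blast
    show ?thesis unfolding free_max_def E by blast
  next
    case False
    \<comment> \<open>In the edgeless host, any \<open>card (verts F)\<close> vertices span a copy
      of \<open>F\<close>.\<close>
    have "free_max r F G n < card (verts F)" for n
    proof (rule free_max_less[OF False H])
      fix S assume "S \<subseteq> verts (H n)" and S: "card S = card (verts F)"
      have "finite S" by (metis False F(1) S card_eq_0_iff)
      then obtain \<phi> where "bij_betw \<phi> (verts F) S" using F(1) S finite_same_card_bij by metis
      then show "\<not> is_free F (induced (H n) S)" by (rule iso) simp
    qed
    then show ?thesis by (meson less_imp_le)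
  qed
qed

section \<open>Asymptotics and the choice of constants\<close>

lemma filterlim_ln_powr_at_top:
  fixes C a :: real
  assumes "0 < C" "0 < a"
  shows "filterlim (\<lambda>n. (C * ln (real n)) powr a) at_top sequentially"
proof -
  have "filterlim (\<lambda>x. exp (a * ln x)) at_top at_top"
    using assms
    by (intro filterlim_compose[OF exp_at_top] filterlim_tendsto_pos_mult_at_top[OF tendsto_const]
        ln_at_top)
  moreover have "\<forall>\<^sub>F x in at_top. exp (a * ln x) = x powr a"
    using eventually_gt_at_top[of 0] by eventually_elim (simp add: powr_def)
  ultimately have "filterlim (\<lambda>x. x powr a) at_top at_top"
    by (simp add: filterlim_cong[OF refl refl])
  moreover have "filterlim (\<lambda>n. C * ln (real n)) at_top sequentially"
    using assms(1)
    by (intro filterlim_tendsto_pos_mult_at_top[OF tendsto_const]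
        filterlim_compose[OF ln_at_top filterlim_real_sequentially])
  ultimately show ?thesis by (rule filterlim_compose)
qed

lemma free_max_le_ln_powr:
  fixes F :: "'b hypergraph" and G :: "'a hypergraph"
  assumes F: "rgraph r F" "edges F \<noteq> {}" and k: "2 \<le> k" "k < r"
    and G: "rgraph r G" "\<not> shadow_homomorphic k G F"
    and v: "v = card (verts F)"
    and C: "C = real k ^ k * (real (v choose k) ^ 2 * real v ^ (k * (v choose k)))"
  shows "\<forall>\<^sub>F n in sequentially.
    real (free_max r F G n) \<le> (C * ln (real n)) powr (1 / (real k - 1))"
proof -
  have finV: "finite (verts F)" using F by (simp add: rgraph_def)
  obtain e where "e \<in> nsets (verts F) r" using F by (auto simp: rgraph_def)
  then have "r \<le> v" using finV v by (auto simp: nsets_def intro: card_mono)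
  then have kv: "k \<le> v" using k by simp
  have C0: "C > 0" unfolding C using kv k by simp
  define x where "x n = (C * ln (real n)) powr (1 / (real k - 1))" for n
  have "filterlim x at_top sequentially"
    unfolding x_def using C0 k by (intro filterlim_ln_powr_at_top) auto
  \<comment> \<open>Large \<open>n\<close> gives \<open>v \<le> m\<close> below, and
    \<open>2 \<le> n\<close> makes \<open>ln n\<close> positive.\<close>
  then have "\<forall>\<^sub>F n in sequentially. real v \<le> x n" by (simp add: filterlim_at_top)
  moreover have "\<forall>\<^sub>F n in sequentially. 2 \<le> n" by (rule eventually_ge_at_top)
  ultimately have "\<forall>\<^sub>F n in sequentially. real (free_max r F G n) \<le> x n"
  proof eventually_elim
    case (elim n)
    \<comment> \<open>The least integer above \<open>x n\<close>. Strictness gives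
      \<open>C * ln n < m ^ (k - 1)\<close>, which is \<open>large\<close> after multiplying by
      \<open>m / C\<close>, while \<open>free_max < m\<close> still yields the bound
      \<open>x n\<close> itself.\<close>
    define m where "m = nat \<lfloor>x n\<rfloor> + 1"
    have x0: "0 \<le> x n" by (simp add: x_def)
    have mx: "x n < m" and mx': "real (m - 1) \<le> x n" using x0 unfolding m_def by linarith+
    have ln0: "0 < C * ln (real n)" using elim C0 by simp
    have "C * ln (real n) = x n powr real (k - 1)"
      using ln0 k by (simp add: x_def powr_powr of_nat_diff)
    also have "\<dots> < real m powr real (k - 1)"
      using mx x0 k by (intro powr_less_mono2) auto
    also have "\<dots> = real m ^ (k - 1)"
      by (rule powr_realpow) (simp add: m_def)
    finally have "ln (real n) < real m ^ (k - 1) / C"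
      using C0 by (simp add: field_simps)
    then have "real m * ln (real n) < real m * (real m ^ (k - 1) / C)"
      by (rule mult_strict_left_mono) (simp add: m_def)
    also have "\<dots> = real m * real m ^ (k - 1) / C" by simp
    also have "real m * real m ^ (k - 1) = real m ^ k"
      using k by (simp flip: power_Suc)
    finally have "real m * ln (real n) <
      (real m / real k) ^ k / (real (v choose k) ^ 2 * real v ^ (k * (v choose k)))"
      by (simp add: C power_divide)
    moreover have "v \<le> m" using mx elim by linarith
    ultimately obtain g :: "nat set \<Rightarrow> nat \<Rightarrow> 'b" where g: "\<And>M. M \<in> nsets {..<n} m \<Longrightarrow> \<exists>W \<subseteq> M. \<exists>\<phi>.
        bij_betw \<phi> W (verts F) \<and> (\<forall>S \<in> nsets W k. \<forall>x\<in>S. g S x = \<phi> x)"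
      using exists_labelling[OF finV v[symmetric] _ kv, of m n] k elim by auto
    have "free_max r F G n < m"
    proof (rule free_max_less[where H = "label_graph r k F g {..<n}"])
      show "verts F \<noteq> {}" using v kv k by auto
      show "rgraph r (label_graph r k F g {..<n})" by (simp add: rgraph_label_graph)
      show "card (verts (label_graph r k F g {..<n})) = n" by (simp add: label_graph_def)
      show "is_free G (label_graph r k F g {..<n})" using G by (rule is_free_label_graph)
      show "\<not> is_free F (induced (label_graph r k F g {..<n}) S)"
        if "S \<subseteq> verts (label_graph r k F g {..<n})" "card S = m" for S
      proof -
        have S: "S \<subseteq> {..<n}" using that by (simp add: label_graph_def)
        then have "S \<in> nsets {..<n} m" using that finite_subset by (auto simp: nsets_def)
        then obtain W \<phi> where "W \<subseteq> S" "bij_betw \<phi> W (verts F)"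
          "\<And>S x. S \<in> nsets W k \<Longrightarrow> x \<in> S \<Longrightarrow> g S x = \<phi> x"
          using g by meson
        then show ?thesis using F(1) S by (intro not_is_free_label_graph)
      qed
    qed
    then show ?case using mx' by linarith
  qed
  then show ?thesis by (simp add: x_def)
qed

theorem theorem1p7:
  fixes F :: "'b hypergraph" and r :: nat
  assumes "rgraph r F"
  shows "\<exists>c :: real. \<forall>(k :: nat) (G :: 'a hypergraph).
    2 \<le> k \<and> k < r \<and> rgraph r G \<and> \<not> shadow_homomorphic k G F \<longrightarrow>
    (\<forall>\<^sub>F n in sequentially.
       real (free_max r F G n) \<le> c * ln (real n) powr (1 / (real k - 1)))"
proof -
  define v where "v = card (verts F)"
  define C where "C k = real k ^ k * (real (v choose k) ^ 2 * real v ^ (k * (v choose k)))" for k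
  \<comment> \<open>Summing over all \<open>k < r\<close> makes \<open>c\<close> independent of
    \<open>k\<close> and \<open>G\<close>. The summand \<open>1\<close> covers edgeless
    \<open>F\<close>, where \<open>1 \<le> c\<close> is needed.\<close>
  define c where "c = 1 + (\<Sum>k<r. C k powr (1 / (real k - 1)))"
  have "\<forall>\<^sub>F n in sequentially. real (free_max r F G n) \<le> c * ln (real n) powr (1 / (real k - 1))"
    if k: "2 \<le> k" "k < r" and G: "rgraph r G" "\<not> shadow_homomorphic k G F"
    for k and G :: "'a hypergraph"
  proof (cases "edges F = {}")
    case True
    \<comment> \<open>An edgeless \<open>G\<close> would be shadow-homomorphic to any
      \<open>F\<close> vacuously.\<close>
    have "edges G \<noteq> {}" using G(2) by (auto simp: shadow_homomorphic_def shadow_def)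
    then obtain K where K: "\<And>n. free_max r F G n \<le> K"
      using free_max_bounded_edgeless True assms by (metis rgraph_def)
    have c1: "1 \<le> c" unfolding c_def by (simp add: sum_nonneg)
    have "filterlim (\<lambda>n. (1 * ln (real n)) powr (1 / (real k - 1))) at_top sequentially"
      using k by (intro filterlim_ln_powr_at_top) auto
    then have "\<forall>\<^sub>F n in sequentially. real K \<le> ln (real n) powr (1 / (real k - 1))"
      by (simp add: filterlim_at_top)
    then show ?thesis
    proof eventually_elim
      case (elim n)
      have "real (free_max r F G n) \<le> 1 * ln (real n) powr (1 / (real k - 1))"
        using elim of_nat_mono[OF K[of n], where ?'a = real] by linarith
      also have "\<dots> \<le> c * ln (real n) powr (1 / (real k - 1))"
        using c1 by (intro mult_right_mono) auto
      finally show ?case .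
    qed
  next
    case False
    have ck: "C k powr (1 / (real k - 1)) \<le> c"
      unfolding c_def using k member_le_sum[of k "{..<r}" "\<lambda>k. C k powr (1 / (real k - 1))"]
      by simp
    have "\<forall>\<^sub>F n in sequentially. real (free_max r F G n) \<le> (C k * ln (real n)) powr (1 / (real k - 1))"
      by (rule free_max_le_ln_powr[OF assms False k G v_def C_def])
    then show ?thesis
    proof eventually_elim
      case (elim n)
      have "(C k * ln (real n)) powr (1 / (real k - 1))
          = C k powr (1 / (real k - 1)) * ln (real n) powr (1 / (real k - 1))"
        by (rule powr_mult)
      also have "\<dots> \<le> c * ln (real n) powr (1 / (real k - 1))"
        using ck by (intro mult_right_mono) auto
      finally show ?case using elim by linarith
    qed
  qed
  then show ?thesis by blast
qed

end
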